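(* Let $d\ge1$ and let $\|\cdot\|$ be any norm on $\mathbb{R}^d$. Then $D_d^*\le 4$; in other words, every grid-like sequence $A_0,A_1,\ldots,A_n\subset\mathbb{R}^d$ has a transversal $T$ with $D(T)\le 4$.
   Context: Let $B_d$ be the (closed) unit ball of a norm $\|\cdot\|$ on $\mathbb{R}^d$. A sequence of closed sets $A_0,A_1,\ldots,A_n\subset\mathbb{R}^d$ ($n\ge1$) is called a grid-like sequence if (i) $A_0=\{0\}$ and $A_n=\{s\}$ for some fixed $s\in\mathbb{R}^d$, and (ii) $(a+B_d)\cap A_i\neq\emptyset$ for every $i\in\{1,\ldots,n-1\}$ and every $a\in\mathbb{R}^d$. A transversal of $A_0,\ldots,A_n$ is a selection $T=(a_0,a_1,\ldots,a_n)$ with $a_i\in A_i$ for every $i=0,\ldots,n$. Given a transversal $T$, put $z_i=a_i-a_{i-1}$ for $i\in\{1,\ldots,n\}$ and $$D(T)=D(T,(A_i))=\max_{1\le i,j\le n}\|z_i-z_j\|.$$ Define $D_d^*=\sup_{(A_i)}\min_T D(T,(A_i))$, where the supremum is over all grid-like sequences $(A_i)$ in $\mathbb{R}^d$ (of all lengths $n\ge 1$) and the minimum is over all transversals $T$ of $(A_i)$ (this minimum always exists because the sets $A_i$ are closed). *)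

theory Defs
  imports "HOL-Analysis.Analysis"
begin

text \<open>An arbitrary norm \<open>N\<close> on \<open>real ^ 'd\<close>, unrelated to the Euclidean \<^const>\<open>norm\<close>
  of the type. All norms induce the same topology, so \<^const>\<open>closed\<close> keeps its meaning.\<close>

definition is_norm :: "(real ^ 'd \<Rightarrow> real) \<Rightarrow> bool" where
  "is_norm N \<longleftrightarrow>
     (\<forall>x. N x = 0 \<longleftrightarrow> x = 0) \<and>
     (\<forall>c x. N (c *\<^sub>R x) = \<bar>c\<bar> * N x) \<and>
     (\<forall>x y. N (x + y) \<le> N x + N y)"

definition unit_ball :: "(real ^ 'd \<Rightarrow> real) \<Rightarrow> (real ^ 'd) set" where
  "unit_ball N = {x. N x \<le> 1}"

text \<open>A sequence \<open>A\<^sub>0, \<dots>, A\<^sub>n\<close> is a function on \<^typ>\<open>nat\<close> together with \<open>n\<close>;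
  the values at indices above \<open>n\<close> play no role. The same convention holds for transversals.\<close>

definition grid_like :: "(real ^ 'd \<Rightarrow> real) \<Rightarrow> nat \<Rightarrow> (nat \<Rightarrow> (real ^ 'd) set) \<Rightarrow> bool" where
  "grid_like N n A \<longleftrightarrow>
     n \<ge> 1 \<and>
     (\<forall>i\<le>n. closed (A i)) \<and>
     A 0 = {0} \<and> (\<exists>s. A n = {s}) \<and>
     (\<forall>i\<in>{1..n-1}. \<forall>a. ((+) a ` unit_ball N) \<inter> A i \<noteq> {})"

definition transversal :: "nat \<Rightarrow> (nat \<Rightarrow> (real ^ 'd) set) \<Rightarrow> (nat \<Rightarrow> real ^ 'd) \<Rightarrow> bool" where
  "transversal n A T \<longleftrightarrow> (\<forall>i\<le>n. T i \<in> A i)"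

definition step :: "(nat \<Rightarrow> real ^ 'd) \<Rightarrow> nat \<Rightarrow> real ^ 'd" where
  "step T i = T i - T (i - 1)"

definition discrepancy :: "(real ^ 'd \<Rightarrow> real) \<Rightarrow> nat \<Rightarrow> (nat \<Rightarrow> real ^ 'd) \<Rightarrow> real" where
  "discrepancy N n T = Max {N (step T i - step T j) | i j. i \<in> {1..n} \<and> j \<in> {1..n}}"

text \<open>The supremum is taken in \<^typ>\<open>ereal\<close>, so that it is \<open>\<infinity>\<close> (not an unspecified real)
  if the minima are unbounded. The infimum over transversals is the minimum of the
  definition: it is attained because the sets are closed.\<close>

definition D_star :: "(real ^ 'd \<Rightarrow> real) \<Rightarrow> ereal" where
  "D_star N =
     (SUP (n, A) \<in> {(n, A). grid_like N n A}.
        INF T \<in> {T. transversal n A T}. ereal (discrepancy N n T))"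

end

theory Submission
  imports Defs
begin

text \<open>
  A transversal that shadows the uniform walk \<open>0, s/n, 2s/n, \<dots>, s\<close> works. Each set in the
  middle of the sequence meets every translate of the unit ball, so it has a point at
  distance at most \<open>1\<close> from \<open>(i/n) s\<close>, and the two end sets contain the walk's ends exactly
  (\<open>transversal_near_uniform_walk\<close>).
  The walk has constant step \<open>s/n\<close>. Perturbing its points by errors \<open>e i\<close> of norm at most \<open>1\<close>
  changes the difference of the steps \<open>i\<close> and \<open>j\<close> from \<open>0\<close> to
  \<open>(e i - e (i-1)) - (e j - e (j-1))\<close>, a signed sum of four errors; hence the bound \<open>4\<close>
  (\<open>discrepancy_near_uniform_walk\<close>).
\<close>

lemma is_norm_zero: "is_norm N \<Longrightarrow> N 0 = 0"
  by (simp add: is_norm_def)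

lemma is_norm_diff_le:
  assumes "is_norm N"
  shows "N (x - y) \<le> N x + N y"
proof -
  have "N (x + (- 1) *\<^sub>R y) \<le> N x + N ((- 1) *\<^sub>R y)"
    using assms unfolding is_norm_def by blast
  also have "N ((- 1) *\<^sub>R y) = \<bar>- 1\<bar> * N y"
    using assms unfolding is_norm_def by blast
  finally show ?thesis by simp
qed

lemma transversal_near_uniform_walk:
  assumes N: "is_norm N" and grid: "grid_like N n A"
  obtains s T where "transversal n A T"
    and "\<And>i. i \<le> n \<Longrightarrow> N (T i - (real i / real n) *\<^sub>R s) \<le> 1"
proof -
  from grid obtain s where n: "n \<ge> 1" and A0: "A 0 = {0}" and An: "A n = {s}"
    and meets: "\<And>i a. i \<in> {1..n-1} \<Longrightarrow> ((+) a ` unit_ball N) \<inter> A i \<noteq> {}"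
    unfolding grid_like_def by blast
  have near: "\<exists>x\<in>A i. N (x - (real i / real n) *\<^sub>R s) \<le> 1" if "i \<le> n" for i
  proof -
    consider "i = 0" | "i = n" | "i \<in> {1..n-1}"
      using \<open>i \<le> n\<close> by (cases "i = 0 \<or> i = n") auto
    then show ?thesis
    proof cases
      case 1
      then show ?thesis using A0 is_norm_zero[OF N] by simp
    next
      case 2
      then show ?thesis using An n is_norm_zero[OF N] by simp
    next
      case 3
      then show ?thesis
        using meets[of i "(real i / real n) *\<^sub>R s"] by (force simp: unit_ball_def)
    qed
  qed
  then have "\<forall>i. \<exists>x. i \<le> n \<longrightarrow> x \<in> A i \<and> N (x - (real i / real n) *\<^sub>R s) \<le> 1"
    by blast
  then obtain T where "\<And>i. i \<le> n \<Longrightarrow> T i \<in> A i \<and> N (T i - (real i / real n) *\<^sub>R s) \<le> 1"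
    by metis
  then show ?thesis
    by (intro that[of T s]) (auto simp: transversal_def)
qed

lemma discrepancy_le:
  assumes "n \<ge> 1"
    and "\<And>i j. i \<in> {1..n} \<Longrightarrow> j \<in> {1..n} \<Longrightarrow> N (step T i - step T j) \<le> c"
  shows "discrepancy N n T \<le> c"
proof -
  let ?S = "{N (step T i - step T j) | i j. i \<in> {1..n} \<and> j \<in> {1..n}}"
  have "?S = (\<lambda>(i, j). N (step T i - step T j)) ` ({1..n} \<times> {1..n})"
    by (fastforce simp: image_iff)
  then have "finite ?S"
    by simp
  moreover have "?S \<noteq> {}"
    using assms(1) by fastforce
  ultimately show ?thesis
    unfolding discrepancy_def using assms(2) by (subst Max_le_iff) auto
qed

text \<open>
  Subtracting a common vector from all steps leaves their differences unchanged, so it is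
  enough that every step lies within \<open>2\<close> of the constant step \<open>v\<close>: one unit of error from
  each of its two endpoints.
\<close>

lemma discrepancy_near_uniform_walk:
  assumes N: "is_norm N" and n: "n \<ge> 1"
    and near: "\<And>i. i \<le> n \<Longrightarrow> N (T i - real i *\<^sub>R v) \<le> 1"
  shows "discrepancy N n T \<le> 4"
proof (rule discrepancy_le[OF n])
  define e where "e i = T i - real i *\<^sub>R v" for i
  have step_error: "N (step T i - v) \<le> 2" if "i \<in> {1..n}" for i
  proof -
    have "step T i - v = e i - e (i - 1)"
      using that by (simp add: step_def e_def of_nat_diff algebra_simps)
    also have "N \<dots> \<le> N (e i) + N (e (i - 1))"
      by (rule is_norm_diff_le[OF N])
    also have "\<dots> \<le> 1 + 1"
      unfolding e_def by (intro add_mono near) (use that in auto)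
    finally show ?thesis by simp
  qed
  fix i j assume ij: "i \<in> {1..n}" "j \<in> {1..n}"
  have "N (step T i - step T j) = N ((step T i - v) - (step T j - v))"
    by simp
  also have "\<dots> \<le> N (step T i - v) + N (step T j - v)"
    by (rule is_norm_diff_le[OF N])
  also have "\<dots> \<le> 4"
    using step_error[OF ij(1)] step_error[OF ij(2)] by simp
  finally show "N (step T i - step T j) \<le> 4" .
qed

theorem proposition1p4:
  fixes N :: "real ^ 'd \<Rightarrow> real"
  assumes "is_norm N"
  shows "D_star N \<le> 4 \<and>
    (\<forall>n A. grid_like N n A \<longrightarrow> (\<exists>T. transversal n A T \<and> discrepancy N n T \<le> 4))"
proof -
  have ex: "\<exists>T. transversal n A T \<and> discrepancy N n T \<le> 4" if grid: "grid_like N n A" for n A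
  proof -
    obtain s T where T: "transversal n A T"
      and near: "\<And>i. i \<le> n \<Longrightarrow> N (T i - (real i / real n) *\<^sub>R s) \<le> 1"
      using transversal_near_uniform_walk[OF assms grid] by blast
    have "discrepancy N n T \<le> 4"
    proof (rule discrepancy_near_uniform_walk[OF assms])
      show "n \<ge> 1" using grid by (simp add: grid_like_def)
      show "N (T i - real i *\<^sub>R ((1 / real n) *\<^sub>R s)) \<le> 1" if "i \<le> n" for i
        using near[OF that] by simp
    qed
    with T show ?thesis by blast
  qed
  have "D_star N \<le> 4"
    unfolding D_star_def
  proof (rule SUP_least, clarify)
    fix n A assume "grid_like N n A"
    then obtain T where "transversal n A T" "discrepancy N n T \<le> 4"
      using ex by blast
    then show "(INF T \<in> {T. transversal n A T}. ereal (discrepancy N n T)) \<le> 4"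
      by (intro INF_lower2[of T]) auto
  qed
  with ex show ?thesis by blast
qed

end
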